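(* Let $f : \mathbb{R}^{n}\rightarrow \mathbb{R}$ and let $x\in \mathbb{R}^{n}$ be a local solution (local minimizer) of the problem $\min_{y\in \mathbb{R}^{n}} f(y)$. Then $f'(x,d)\geq 0$ for every direction $d\in \mathbb{R}^{n}$ for which the directional derivative $f'(x,d)$ exists.
   Context: The directional derivative of $f$ at $x$ in the direction $d$ is $f'(x,d)=\lim_{t \downarrow 0}\frac{f(x + td) -f(x)}{t}$, when this limit exists. A point $x\in\mathbb{R}^n$ is a local minimizer (local solution) of $\min_{y\in\mathbb{R}^n} f(y)$ if there exists $\varepsilon>0$ such that $f(x)\leq f(y)$ for all $y\in\mathbb{R}^n$ with $\|x-y\|\leq\varepsilon$. *)

theory Defs
  imports "HOL-Analysis.Analysis"
begin

definition difference_quotient :: "(real ^ 'n \<Rightarrow> real) \<Rightarrow> real ^ 'n \<Rightarrow> real ^ 'n \<Rightarrow> real \<Rightarrow> real" where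
  "difference_quotient f x d t = (f (x + t *\<^sub>R d) - f x) / t"

(* The limit is required to exist as a real number; infinite limits do not count. *)
definition dir_differentiable :: "(real ^ 'n \<Rightarrow> real) \<Rightarrow> real ^ 'n \<Rightarrow> real ^ 'n \<Rightarrow> bool" where
  "dir_differentiable f x d \<longleftrightarrow> (\<exists>L. (difference_quotient f x d \<longlongrightarrow> L) (at_right 0))"

(* Only meaningful under dir_differentiable f x d; otherwise the value of Lim is unspecified. *)
definition dir_deriv :: "(real ^ 'n \<Rightarrow> real) \<Rightarrow> real ^ 'n \<Rightarrow> real ^ 'n \<Rightarrow> real" where
  "dir_deriv f x d = Lim (at_right 0) (difference_quotient f x d)"

definition local_minimizer :: "(real ^ 'n \<Rightarrow> real) \<Rightarrow> real ^ 'n \<Rightarrow> bool" where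
  "local_minimizer f x \<longleftrightarrow> (\<exists>\<epsilon>>0. \<forall>y. norm (x - y) \<le> \<epsilon> \<longrightarrow> f x \<le> f y)"

end

theory Submission imports Defs begin

text \<open>For small \<open>t > 0\<close> the point \<open>x + t *\<^sub>R d\<close> lies in the
  ball on which \<open>f x\<close> is minimal, so the difference quotient has a nonnegative
  numerator over a positive denominator.
  \<open>local_minimizer_eventually_difference_quotient_nonneg\<close> records this, and a weak
  lower bound survives passage to the limit.\<close>

lemma local_minimizer_eventually_difference_quotient_nonneg:
  fixes f :: "real ^ 'n \<Rightarrow> real"
  assumes "local_minimizer f x"
  shows "\<forall>\<^sub>F t in at_right 0. 0 \<le> difference_quotient f x d t"
proof -
  obtain e where "e > 0" and min: "\<And>y. norm (x - y) \<le> e \<Longrightarrow> f x \<le> f y"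
    using assms unfolding local_minimizer_def by blast
  \<comment> \<open>The displacement from \<open>x\<close> shrinks to 0 with \<open>t\<close>, so it
    eventually falls below the radius \<open>e\<close>, whatever the length of
    \<open>d\<close>.\<close>
  have "((\<lambda>t. norm (t *\<^sub>R d)) \<longlongrightarrow> norm (0 *\<^sub>R d)) (at_right 0)"
    by (intro tendsto_intros)
  then have "\<forall>\<^sub>F t in at_right 0. norm (t *\<^sub>R d) < e"
    by (rule order_tendstoD(2)) (use \<open>e > 0\<close> in simp)
  moreover have "\<forall>\<^sub>F t::real in at_right 0. 0 < t"
    by (rule eventually_at_right_less)
  ultimately show ?thesis
  proof eventually_elim
    case (elim t)
    then have "f x \<le> f (x + t *\<^sub>R d)"
      by (intro min) simp
    with elim show ?case
      by (simp add: difference_quotient_def)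
  qed
qed

theorem proposition3p4:
  fixes f :: "real ^ 'n \<Rightarrow> real" and x :: "real ^ 'n"
  assumes "local_minimizer f x"
  shows "\<forall>d :: real ^ 'n. dir_differentiable f x d \<longrightarrow> dir_deriv f x d \<ge> 0"
proof (intro allI impI)
  fix d :: "real ^ 'n"
  assume "dir_differentiable f x d"
  then obtain L where L: "(difference_quotient f x d \<longlongrightarrow> L) (at_right 0)"
    unfolding dir_differentiable_def by blast
  \<comment> \<open>Existence of the limit pins down the value of \<open>Lim\<close>. Both this
    uniqueness and the bound on \<open>L\<close> rest on \<open>at_right 0\<close> being a
    nontrivial filter, which the simplifier discharges.\<close>
  then have "dir_deriv f x d = L"
    unfolding dir_deriv_def by (intro tendsto_Lim) simp_all
  moreover have "0 \<le> L"
    using L local_minimizer_eventually_difference_quotient_nonneg[OF assms]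
    by (rule tendsto_lowerbound) simp
  ultimately show "dir_deriv f x d \<ge> 0"
    by simp
qed

end
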